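(* Let $\mathfrak g$ be a simply-laced simple Lie algebra of rank $r$ with Cartan matrix $C$. A family of functions $\{\mathcal Q_{\alpha,k}(\mathbf u):1\le\alpha\le r,\ k\in\mathbb Z_{\ge0}\}$ satisfies $$\mathcal Q_{\alpha,0}=1,\quad\mathcal Q_{\alpha,1}=u_\alpha^{-1},\quad\mathcal Q_{\alpha,k+1}(\mathbf u)=\frac{\mathcal Q_{\alpha,k}(\mathbf u)^2-\prod_{\beta\ne\alpha}\mathcal Q_{\beta,k}(\mathbf u)^{-C_{\beta,\alpha}}}{u_{\alpha,k}\,\mathcal Q_{\alpha,k-1}(\mathbf u)}\quad(k\ge1)$$ if and only if it satisfies the recursion $$\mathcal Q_{\alpha,0}=1,\quad\mathcal Q_{\alpha,1}=u_\alpha^{-1},\quad\mathcal Q_{\alpha,k+1}(\mathbf u)=\mathcal Q_{\alpha,k}(\mathbf u')\quad(k\ge1),$$ where $$u'_\alpha=\frac1{\mathcal Q_{\alpha,2}(\mathbf u)},\qquad u'_{\alpha,1}=\mathcal Q_{\alpha,1}(\mathbf u)\,u_{\alpha,2},\qquad u'_{\alpha,l}=u_{\alpha,l+1}\ (l>1),$$ and $\mathcal Q_{\alpha,2}(\mathbf u)$ is defined by $$\mathcal Q_{\alpha,2}(\mathbf u)=\frac{1-\prod_{\beta}u_\beta^{C_{\beta,\alpha}}}{u_\alpha^2\,u_{\alpha,1}}.$$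
   Context: $\mathbf u=\{u_\alpha;u_{\alpha,i}\mid1\le\alpha\le r,\ i\ge1\}$ are formal variables and the $\mathcal Q_{\alpha,k}(\mathbf u)$ are rational functions of them; $\mathcal Q_{\alpha,k}(\mathbf u')$ denotes substitution of $\mathbf u'$ for $\mathbf u$. *)

theory Defs
  imports
    Complex_Main
    "HOL-Library.Poly_Mapping"
    "HOL-Library.Product_Lexorder"
    "HOL-Computational_Algebra.Fraction_Field"
begin

section \<open>Complex Lie algebras and their Cartan matrices\<close>

locale lie_algebra = vector_space scale
  for scale :: "complex \<Rightarrow> 'g::ab_group_add \<Rightarrow> 'g" +
  fixes bracket :: "'g \<Rightarrow> 'g \<Rightarrow> 'g"
  assumes bracket_add_left: "bracket (x + y) z = bracket x z + bracket y z"
    and bracket_add_right: "bracket x (y + z) = bracket x y + bracket x z"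
    and bracket_scale_left: "bracket (scale c x) y = scale c (bracket x y)"
    and bracket_scale_right: "bracket x (scale c y) = scale c (bracket x y)"
    and bracket_self: "bracket x x = 0"
    and jacobi: "bracket x (bracket y z) + bracket y (bracket z x) + bracket z (bracket x y) = 0"
begin

definition lie_subalgebra :: "'g set \<Rightarrow> bool" where
  "lie_subalgebra h \<longleftrightarrow> subspace h \<and> (\<forall>x\<in>h. \<forall>y\<in>h. bracket x y \<in> h)"

definition lie_ideal :: "'g set \<Rightarrow> bool" where
  "lie_ideal I \<longleftrightarrow> subspace I \<and> (\<forall>x. \<forall>y\<in>I. bracket x y \<in> I)"

definition product_space :: "'g set \<Rightarrow> 'g set \<Rightarrow> 'g set" where
  "product_space A B = span {bracket x y | x y. x \<in> A \<and> y \<in> B}"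

primrec lower_central :: "'g set \<Rightarrow> nat \<Rightarrow> 'g set" where
  "lower_central h 0 = h"
| "lower_central h (Suc n) = product_space h (lower_central h n)"

definition lie_nilpotent :: "'g set \<Rightarrow> bool" where
  "lie_nilpotent h \<longleftrightarrow> (\<exists>n. lower_central h n = {0})"

definition normalizer :: "'g set \<Rightarrow> 'g set" where
  "normalizer h = {x. \<forall>y\<in>h. bracket x y \<in> h}"

definition cartan_subalgebra :: "'g set \<Rightarrow> bool" where
  "cartan_subalgebra h \<longleftrightarrow> lie_subalgebra h \<and> lie_nilpotent h \<and> normalizer h = h"

text \<open>
  Weights are functions on all of the Lie algebra of which only the values on \<open>h\<close> matter.
  Below, \<open>weight_space h \<mu> \<noteq> {0}\<close> already forces \<open>\<mu>\<close> to be linear on \<open>h\<close>.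
  Eigenspaces suffice because a Cartan subalgebra of a semisimple Lie algebra acts diagonalizably.
\<close>

definition weight_space :: "'g set \<Rightarrow> ('g \<Rightarrow> complex) \<Rightarrow> 'g set" where
  "weight_space h \<mu> = {x. \<forall>t\<in>h. bracket t x = scale (\<mu> t) x}"

definition is_root :: "'g set \<Rightarrow> ('g \<Rightarrow> complex) \<Rightarrow> bool" where
  "is_root h \<mu> \<longleftrightarrow> (\<exists>t\<in>h. \<mu> t \<noteq> 0) \<and> weight_space h \<mu> \<noteq> {0}"

definition simple_roots :: "'g set \<Rightarrow> ('r::finite \<Rightarrow> 'g \<Rightarrow> complex) \<Rightarrow> bool" where
  "simple_roots h a \<longleftrightarrow>
     (\<forall>i. is_root h (a i)) \<and>
     (\<forall>c. (\<forall>t\<in>h. (\<Sum>i\<in>UNIV. c i * a i t) = 0) \<longrightarrow> (\<forall>i. c i = 0)) \<and>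
     (\<forall>\<mu>. is_root h \<mu> \<longrightarrow> (\<exists>n :: 'r \<Rightarrow> nat.
        (\<forall>t\<in>h. \<mu> t = (\<Sum>i\<in>UNIV. of_nat (n i) * a i t)) \<or>
        (\<forall>t\<in>h. \<mu> t = - (\<Sum>i\<in>UNIV. of_nat (n i) * a i t))))"

text \<open>
  The coroot of \<open>\<mu>\<close> is the unique element of \<open>[\<gg>\<^sub>\<mu>, \<gg>\<^sub>-\<^sub>\<mu>]\<close> on which \<open>\<mu>\<close> takes the value 2;
  that space is contained in \<open>h\<close>.
\<close>

definition coroot :: "'g set \<Rightarrow> ('g \<Rightarrow> complex) \<Rightarrow> 'g \<Rightarrow> bool" where
  "coroot h \<mu> t \<longleftrightarrow>
     t \<in> product_space (weight_space h \<mu>) (weight_space h (\<lambda>s. - \<mu> s)) \<and> \<mu> t = 2"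

text \<open>
  The simple roots are indexed by the finite type \<open>'r\<close>; being a basis of the dual of \<open>h\<close>,
  they make \<open>CARD('r)\<close> the rank.  Convention: \<open>C i j\<close> is the value of the \<open>j\<close>-th simple root
  at the \<open>i\<close>-th simple coroot.
\<close>

definition cartan_matrix :: "('r::finite \<Rightarrow> 'r \<Rightarrow> int) \<Rightarrow> bool" where
  "cartan_matrix C \<longleftrightarrow> (\<exists>h a H. cartan_subalgebra h \<and> simple_roots h a \<and>
     (\<forall>i. coroot h (a i) (H i)) \<and> (\<forall>i j. of_int (C i j) = a j (H i)))"

end

locale simple_lie_algebra = lie_algebra +
  assumes finite_dim: "\<exists>B. finite B \<and> span B = UNIV"
    and nonabelian: "\<exists>x y. bracket x y \<noteq> 0"
    and no_proper_ideal: "lie_ideal I \<Longrightarrow> I = {0} \<or> I = UNIV"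

definition simply_laced :: "('r \<Rightarrow> 'r \<Rightarrow> int) \<Rightarrow> bool" where
  "simply_laced C \<longleftrightarrow> (\<forall>i j. i \<noteq> j \<longrightarrow> C i j \<in> {0, -1})"


section \<open>Rational functions and substitution\<close>

text \<open>
  The formal variables are indexed by \<open>'r \<times> nat\<close>: index \<open>(\<alpha>, 0)\<close> stands for \<open>u\<^sub>\<alpha>\<close> and
  \<open>(\<alpha>, i)\<close> with \<open>i \<ge> 1\<close> for the variable with the two subscripts \<open>\<alpha>, i\<close>, so no spurious
  variables are introduced.  The order on \<open>'r\<close>, extended lexicographically, is used only
  to obtain that the polynomial ring is an integral domain.
\<close>

type_synonym 'r upoly = "('r \<times> nat \<Rightarrow>\<^sub>0 nat) \<Rightarrow>\<^sub>0 complex"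
type_synonym 'r uratfun = "'r upoly fract"

definition uvar :: "'r::{finite,linorder} \<times> nat \<Rightarrow> 'r uratfun" where
  "uvar v = Fract (Poly_Mapping.single (Poly_Mapping.single v 1) 1) 1"

definition u :: "'r::{finite,linorder} \<Rightarrow> 'r uratfun" where
  "u \<alpha> = uvar (\<alpha>, 0)"

definition ui :: "'r::{finite,linorder} \<Rightarrow> nat \<Rightarrow> 'r uratfun" where
  "ui \<alpha> i = uvar (\<alpha>, i)"

definition uconst :: "complex \<Rightarrow> 'r::{finite,linorder} uratfun" where
  "uconst c = Fract (Poly_Mapping.single 0 c) 1"

definition poly_subst ::
    "('r::{finite,linorder} \<times> nat \<Rightarrow> 'r uratfun) \<Rightarrow> 'r upoly \<Rightarrow> 'r uratfun" where
  "poly_subst \<sigma> p =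
     (\<Sum>m\<in>Poly_Mapping.keys p. uconst (Poly_Mapping.lookup p m) *
       (\<Prod>v\<in>Poly_Mapping.keys m. \<sigma> v ^ Poly_Mapping.lookup m v))"

text \<open>
  The value of \<open>f\<close> after substituting \<open>\<sigma> v\<close> for each variable \<open>v\<close>.  It is meaningful when \<open>f\<close> has
  a representation whose denominator does not vanish under \<open>\<sigma>\<close>; by \<open>rat_subst_Fract\<close> below it then
  does not depend on the representation.
\<close>

definition rat_subst ::
    "('r::{finite,linorder} \<times> nat \<Rightarrow> 'r uratfun) \<Rightarrow> 'r uratfun \<Rightarrow> 'r uratfun" where
  "rat_subst \<sigma> f = (THE g. \<exists>a b. f = Fract a b \<and> b \<noteq> 0 \<and> poly_subst \<sigma> b \<noteq> 0 \<and>
     g = poly_subst \<sigma> a / poly_subst \<sigma> b)"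

lemma uconst_0 [simp]: "uconst 0 = 0"
  by (simp add: uconst_def Zero_fract_def)

lemma uconst_add: "uconst (c + d) = uconst c + uconst d"
  by (simp add: uconst_def single_add)

lemma uconst_mult: "uconst (c * d) = uconst c * uconst d"
  by (simp add: uconst_def mult_single)

lemma poly_subst_superset:
  assumes "finite S" "Poly_Mapping.keys p \<subseteq> S"
  shows "poly_subst \<sigma> p =
     (\<Sum>m\<in>S. uconst (Poly_Mapping.lookup p m) *
       (\<Prod>v\<in>Poly_Mapping.keys m. \<sigma> v ^ Poly_Mapping.lookup m v))"
  unfolding poly_subst_def using assms
  by (intro sum.mono_neutral_left) (auto simp: in_keys_iff)

lemma poly_subst_add: "poly_subst \<sigma> (p + q) = poly_subst \<sigma> p + poly_subst \<sigma> q"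
proof -
  let ?S = "Poly_Mapping.keys p \<union> Poly_Mapping.keys q"
  have "Poly_Mapping.keys (p + q) \<subseteq> ?S" by (rule keys_add)
  then show ?thesis
    by (simp add: poly_subst_superset[of ?S] lookup_add uconst_add distrib_right sum.distrib)
qed

lemma poly_subst_0 [simp]: "poly_subst \<sigma> 0 = 0"
  by (simp add: poly_subst_def)

lemma poly_subst_sum: "poly_subst \<sigma> (\<Sum>i\<in>A. f i) = (\<Sum>i\<in>A. poly_subst \<sigma> (f i))"
  by (induction A rule: infinite_finite_induct) (simp_all add: poly_subst_add)

lemma poly_subst_single:
  "poly_subst \<sigma> (Poly_Mapping.single m c) =
     uconst c * (\<Prod>v\<in>Poly_Mapping.keys m. \<sigma> v ^ Poly_Mapping.lookup m v)"
  by (subst poly_subst_superset[of "{m}"]) auto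

lemma monom_subst_add:
  fixes \<sigma> :: "'v \<Rightarrow> 'a::comm_semiring_1"
  shows "(\<Prod>v\<in>Poly_Mapping.keys (m + n). \<sigma> v ^ Poly_Mapping.lookup (m + n) v) =
     (\<Prod>v\<in>Poly_Mapping.keys m. \<sigma> v ^ Poly_Mapping.lookup m v) *
     (\<Prod>v\<in>Poly_Mapping.keys n. \<sigma> v ^ Poly_Mapping.lookup n v)"
proof -
  let ?S = "Poly_Mapping.keys m \<union> Poly_Mapping.keys n"
  have *: "(\<Prod>v\<in>Poly_Mapping.keys k. \<sigma> v ^ Poly_Mapping.lookup k v) =
      (\<Prod>v\<in>?S. \<sigma> v ^ Poly_Mapping.lookup k v)"
    if "Poly_Mapping.keys k \<subseteq> ?S" for k
    using that by (intro prod.mono_neutral_left) (auto simp: in_keys_iff)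
  show ?thesis
    unfolding *[OF keys_add] *[of m, OF Un_upper1] *[of n, OF Un_upper2]
    by (simp add: lookup_add power_add prod.distrib)
qed

lemma poly_eq_sum_single:
  "p = (\<Sum>m\<in>Poly_Mapping.keys p. Poly_Mapping.single m (Poly_Mapping.lookup p m))"
  by (rule poly_mapping_eqI)
    (auto simp: lookup_sum lookup_single when_def in_keys_iff sum.delta)

lemma poly_subst_mult: "poly_subst \<sigma> (p * q) = poly_subst \<sigma> p * poly_subst \<sigma> q"
proof -
  have "p * q =
      (\<Sum>m\<in>Poly_Mapping.keys p. \<Sum>n\<in>Poly_Mapping.keys q.
        Poly_Mapping.single (m + n) (Poly_Mapping.lookup p m * Poly_Mapping.lookup q n))"
    by (subst poly_eq_sum_single[of p], subst poly_eq_sum_single[of q])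
      (simp add: sum_product mult_single)
  then have "poly_subst \<sigma> (p * q) = (\<Sum>m\<in>Poly_Mapping.keys p. \<Sum>n\<in>Poly_Mapping.keys q.
      (uconst (Poly_Mapping.lookup p m) * (\<Prod>v\<in>Poly_Mapping.keys m. \<sigma> v ^ Poly_Mapping.lookup m v)) *
      (uconst (Poly_Mapping.lookup q n) * (\<Prod>v\<in>Poly_Mapping.keys n. \<sigma> v ^ Poly_Mapping.lookup n v)))"
    by (simp add: poly_subst_sum poly_subst_single uconst_mult monom_subst_add mult_ac)
  then show ?thesis
    by (simp add: poly_subst_def sum_product)
qed

lemma rat_subst_Fract:
  assumes "b \<noteq> 0" "poly_subst \<sigma> b \<noteq> 0"
  shows "rat_subst \<sigma> (Fract a b) = poly_subst \<sigma> a / poly_subst \<sigma> b"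
  unfolding rat_subst_def
proof (rule the_equality)
  fix g
  assume "\<exists>a' b'. Fract a b = Fract a' b' \<and> b' \<noteq> 0 \<and> poly_subst \<sigma> b' \<noteq> 0 \<and>
     g = poly_subst \<sigma> a' / poly_subst \<sigma> b'"
  then obtain a' b' where *: "Fract a b = Fract a' b'" "b' \<noteq> 0" "poly_subst \<sigma> b' \<noteq> 0"
    "g = poly_subst \<sigma> a' / poly_subst \<sigma> b'" by blast
  then have "a * b' = a' * b" using assms by (simp add: eq_fract)
  then have "poly_subst \<sigma> a * poly_subst \<sigma> b' = poly_subst \<sigma> a' * poly_subst \<sigma> b"
    by (metis poly_subst_mult)
  then show "g = poly_subst \<sigma> a / poly_subst \<sigma> b"
    using * assms by (simp add: frac_eq_eq)
qed (use assms in blast)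

text \<open>The substitution \<open>\<^bold>u \<mapsto> \<^bold>u'\<close> built from the members \<open>Q \<alpha> 1\<close>, \<open>Q \<alpha> 2\<close> of a family \<open>Q\<close>.\<close>

fun u_prime ::
    "('r::{finite,linorder} \<Rightarrow> nat \<Rightarrow> 'r uratfun) \<Rightarrow> 'r \<times> nat \<Rightarrow> 'r uratfun" where
  "u_prime Q (\<alpha>, 0) = 1 / Q \<alpha> 2"
| "u_prime Q (\<alpha>, Suc 0) = Q \<alpha> 1 * ui \<alpha> 2"
| "u_prime Q (\<alpha>, Suc (Suc n)) = ui \<alpha> (Suc (Suc (Suc n)))"

end

theory Submission
  imports Defs
begin

text \<open>
  Applying the substitution \<open>\<^bold>u \<mapsto> \<^bold>u'\<close> to the three-term recursion at \<open>k\<close> yields, term by term, the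
  recursion at \<open>k + 1\<close>; at \<open>k = 1\<close> the factor \<open>Q \<alpha> 1\<close> of \<open>u'\<close> at \<open>(\<alpha>, 1)\<close> supplies the
  denominator \<open>Q \<alpha> 1\<close>, because \<open>Q \<alpha> 0 = 1\<close> is invariant.  So both recursions propagate from the same
  initial values, as soon as the substitution is a field endomorphism.  It is one because the \<open>u'\<close>
  are algebraically independent: each is a nonzero rational function of the \<open>u \<alpha>\<close> times the
  variable with the second index raised by one, so that a partially defined substitution fixing
  the \<open>u \<alpha>\<close> inverts it.
\<close>

section \<open>Values of rational functions under a substitution\<close>

text \<open>The condition inside the description operator of \<open>rat_subst\<close>, kept as a
  relation because a partially defined substitution has no value at some rational functions. The
  closure rules below carry definedness along with the value.\<close>

definition has_subst_value ::
    "('r::{finite,linorder} \<times> nat \<Rightarrow> 'r uratfun) \<Rightarrow> 'r uratfun \<Rightarrow> 'r uratfun \<Rightarrow> bool" where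
  "has_subst_value \<sigma> f g \<longleftrightarrow> (\<exists>a b. f = Fract a b \<and> b \<noteq> 0 \<and> poly_subst \<sigma> b \<noteq> 0 \<and>
     g = poly_subst \<sigma> a / poly_subst \<sigma> b)"

lemma has_subst_valueI:
  assumes "f = Fract a b" "poly_subst \<sigma> b \<noteq> 0" "g = poly_subst \<sigma> a / poly_subst \<sigma> b"
  shows "has_subst_value \<sigma> f g"
  using assms poly_subst_0 unfolding has_subst_value_def by metis

lemma has_subst_valueE:
  assumes "has_subst_value \<sigma> f g"
  obtains a b where "f = Fract a b" "b \<noteq> 0" "poly_subst \<sigma> b \<noteq> 0"
    "g = poly_subst \<sigma> a / poly_subst \<sigma> b"
  using assms unfolding has_subst_value_def by blast

lemma rat_subst_eqI: "has_subst_value \<sigma> f g \<Longrightarrow> rat_subst \<sigma> f = g"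
  by (auto elim!: has_subst_valueE simp: rat_subst_Fract)

lemma has_subst_value_unique:
  "has_subst_value \<sigma> f g \<Longrightarrow> has_subst_value \<sigma> f g' \<Longrightarrow> g = g'"
  using rat_subst_eqI by metis

lemma uconst_1 [simp]: "uconst 1 = 1"
  by (simp add: uconst_def One_fract_def)

lemma poly_subst_uconst: "poly_subst \<sigma> (Poly_Mapping.single 0 c) = uconst c"
  by (simp add: poly_subst_single)

lemma poly_subst_1 [simp]: "poly_subst \<sigma> 1 = 1"
  using poly_subst_uconst[of \<sigma> 1] by simp

lemma uconst_minus_1: "uconst (- 1) = - 1"
  using uconst_add[of 1 "- 1"] by (simp add: eq_neg_iff_add_eq_0 add.commute)

lemma has_subst_value_uconst: "has_subst_value \<sigma> (uconst c) (uconst c)"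
  by (rule has_subst_valueI[of _ "Poly_Mapping.single 0 c" 1])
    (simp_all add: uconst_def[of c] poly_subst_uconst)

lemma has_subst_value_0: "has_subst_value \<sigma> 0 0"
  using has_subst_value_uconst[of \<sigma> 0] by simp

lemma has_subst_value_1: "has_subst_value \<sigma> 1 1"
  using has_subst_value_uconst[of \<sigma> 1] by simp

lemma has_subst_value_uvar: "has_subst_value \<sigma> (uvar v) (\<sigma> v)"
  by (rule has_subst_valueI[of _ "Poly_Mapping.single (Poly_Mapping.single v 1) 1" 1])
    (simp_all add: uvar_def poly_subst_single)

lemma has_subst_value_add:
  assumes "has_subst_value \<sigma> f g" "has_subst_value \<sigma> f' g'"
  shows "has_subst_value \<sigma> (f + f') (g + g')"
proof -
  obtain a b where 1: "f = Fract a b" "b \<noteq> 0" "poly_subst \<sigma> b \<noteq> 0"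
    "g = poly_subst \<sigma> a / poly_subst \<sigma> b" using assms(1) by (rule has_subst_valueE)
  obtain a' b' where 2: "f' = Fract a' b'" "b' \<noteq> 0" "poly_subst \<sigma> b' \<noteq> 0"
    "g' = poly_subst \<sigma> a' / poly_subst \<sigma> b'" using assms(2) by (rule has_subst_valueE)
  show ?thesis
    by (rule has_subst_valueI[of _ "a * b' + a' * b" "b * b'"])
      (use 1 2 in \<open>simp_all add: poly_subst_add poly_subst_mult add_frac_eq\<close>)
qed

lemma has_subst_value_mult:
  assumes "has_subst_value \<sigma> f g" "has_subst_value \<sigma> f' g'"
  shows "has_subst_value \<sigma> (f * f') (g * g')"
proof -
  obtain a b where 1: "f = Fract a b" "b \<noteq> 0" "poly_subst \<sigma> b \<noteq> 0"
    "g = poly_subst \<sigma> a / poly_subst \<sigma> b" using assms(1) by (rule has_subst_valueE)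
  obtain a' b' where 2: "f' = Fract a' b'" "b' \<noteq> 0" "poly_subst \<sigma> b' \<noteq> 0"
    "g' = poly_subst \<sigma> a' / poly_subst \<sigma> b'" using assms(2) by (rule has_subst_valueE)
  show ?thesis
    by (rule has_subst_valueI[of _ "a * a'" "b * b'"])
      (use 1 2 in \<open>simp_all add: poly_subst_mult\<close>)
qed

lemma has_subst_value_uminus:
  "has_subst_value \<sigma> f g \<Longrightarrow> has_subst_value \<sigma> (- f) (- g)"
  using has_subst_value_mult[OF has_subst_value_uconst[of \<sigma> "- 1"], of f g]
  by (simp add: uconst_minus_1)

lemma has_subst_value_diff:
  "has_subst_value \<sigma> f g \<Longrightarrow> has_subst_value \<sigma> f' g' \<Longrightarrow> has_subst_value \<sigma> (f - f') (g - g')"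
  using has_subst_value_add[OF _ has_subst_value_uminus, of \<sigma> f g f' g'] by simp

lemma has_subst_value_inverse:
  assumes "has_subst_value \<sigma> f g" "g \<noteq> 0"
  shows "has_subst_value \<sigma> (inverse f) (inverse g)"
proof -
  obtain a b where 1: "f = Fract a b" "b \<noteq> 0" "poly_subst \<sigma> b \<noteq> 0"
    "g = poly_subst \<sigma> a / poly_subst \<sigma> b" using assms(1) by (rule has_subst_valueE)
  show ?thesis
    by (rule has_subst_valueI[of _ b a]) (use 1 assms(2) in auto)
qed

lemma has_subst_value_divide:
  "has_subst_value \<sigma> f g \<Longrightarrow> has_subst_value \<sigma> f' g' \<Longrightarrow> g' \<noteq> 0 \<Longrightarrow>
     has_subst_value \<sigma> (f / f') (g / g')"
  unfolding divide_inverse by (intro has_subst_value_mult has_subst_value_inverse)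

lemma has_subst_value_power:
  "has_subst_value \<sigma> f g \<Longrightarrow> has_subst_value \<sigma> (f ^ n) (g ^ n)"
  by (induction n) (simp_all add: has_subst_value_1 has_subst_value_mult)

lemma has_subst_value_power_int:
  "has_subst_value \<sigma> f g \<Longrightarrow> g \<noteq> 0 \<Longrightarrow> has_subst_value \<sigma> (f powi n) (g powi n)"
  by (auto simp: power_int_def intro: has_subst_value_power has_subst_value_inverse)

lemma has_subst_value_sum:
  "(\<And>x. x \<in> A \<Longrightarrow> has_subst_value \<sigma> (f x) (g x)) \<Longrightarrow> has_subst_value \<sigma> (sum f A) (sum g A)"
  by (induction A rule: infinite_finite_induct)
    (simp_all add: has_subst_value_0 has_subst_value_add)

lemma has_subst_value_prod:
  "(\<And>x. x \<in> A \<Longrightarrow> has_subst_value \<sigma> (f x) (g x)) \<Longrightarrow> has_subst_value \<sigma> (prod f A) (prod g A)"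
  by (induction A rule: infinite_finite_induct)
    (simp_all add: has_subst_value_1 has_subst_value_mult)

text \<open>Composition of substitutions: \<open>poly_subst\<close> is built from constants, sums,
  products and powers, so no denominator arises and values of \<tau> pass through it. With \<rho> =
  \<open>uvar\<close> this recovers a polynomial from its image.\<close>

lemma has_subst_value_poly_subst:
  assumes "\<And>v. has_subst_value \<tau> (\<sigma> v) (\<rho> v)"
  shows "has_subst_value \<tau> (poly_subst \<sigma> p) (poly_subst \<rho> p)"
  unfolding poly_subst_def
  by (intro has_subst_value_sum has_subst_value_mult has_subst_value_uconst
      has_subst_value_prod has_subst_value_power assms)

section \<open>The identity substitution\<close>

lemma Fract_sum: "Fract (\<Sum>i\<in>A. f i) 1 = (\<Sum>i\<in>A. Fract (f i) 1)"
proof (induction A rule: infinite_finite_induct)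
  case (insert x A)
  have "Fract (f x + sum f A) 1 = Fract (f x) 1 + Fract (sum f A) 1" by simp
  then show ?case using insert by simp
qed (simp_all add: Zero_fract_def)

lemma Fract_prod: "Fract (\<Prod>i\<in>A. f i) 1 = (\<Prod>i\<in>A. Fract (f i) 1)"
proof (induction A rule: infinite_finite_induct)
  case (insert x A)
  have "Fract (f x * prod f A) 1 = Fract (f x) 1 * Fract (prod f A) 1" by simp
  then show ?case using insert by simp
qed (simp_all add: One_fract_def)

lemma uvar_power:
  "uvar v ^ n = Fract (Poly_Mapping.single (Poly_Mapping.single v n) 1) 1"
proof (induction n)
  case (Suc n)
  have "Poly_Mapping.single v (Suc 0) + Poly_Mapping.single v n = Poly_Mapping.single v (Suc n)"
    by (simp flip: single_add)
  then show ?case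
    using Suc by (simp add: uvar_def mult_single)
qed (simp add: One_fract_def)

lemma prod_single:
  "(\<Prod>i\<in>A. Poly_Mapping.single (m i) (1 :: complex)) =
     Poly_Mapping.single (\<Sum>i\<in>A. m i :: 'v \<Rightarrow>\<^sub>0 nat) 1"
  by (induction A rule: infinite_finite_induct) (simp_all add: mult_single)

lemma monomial_eq_sum_single:
  fixes m :: "'v \<Rightarrow>\<^sub>0 nat"
  shows "(\<Sum>v\<in>Poly_Mapping.keys m. Poly_Mapping.single v (Poly_Mapping.lookup m v)) = m"
  by (rule poly_mapping_eqI)
    (auto simp: lookup_sum lookup_single when_def in_keys_iff sum.delta)

lemma poly_subst_uvar: "poly_subst uvar p = Fract p 1"
proof -
  have "poly_subst uvar p =
      (\<Sum>m\<in>Poly_Mapping.keys p. Fract (Poly_Mapping.single m (Poly_Mapping.lookup p m)) 1)"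
    unfolding poly_subst_def
    by (simp add: uvar_power uconst_def monomial_eq_sum_single mult_single prod_single
        flip: Fract_prod)
  also have "\<dots> = Fract p 1"
    by (simp flip: Fract_sum poly_eq_sum_single)
  finally show ?thesis .
qed

lemma uvar_nonzero [simp]: "uvar v \<noteq> 0"
  by (simp add: uvar_def Zero_fract_def eq_fract flip: keys_eq_empty)

section \<open>Injective substitutions\<close>

text \<open>A trivial kernel means that the elements \<sigma> v are algebraically independent over
  the complex numbers. Every nonzero denominator then survives, which makes \<open>rat_subst\<close>
  total.\<close>

definition inj_subst :: "('r::{finite,linorder} \<times> nat \<Rightarrow> 'r uratfun) \<Rightarrow> bool" where
  "inj_subst \<sigma> \<longleftrightarrow> (\<forall>p. poly_subst \<sigma> p = 0 \<longrightarrow> p = 0)"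

text \<open>Here \<tau> is a left inverse of \<sigma>. If \<sigma> kills p, applying \<tau> to that
  image gives both 0 and p, and values are unique. Only the values of \<tau> at the images \<sigma>
  v enter, so \<tau> may be undefined elsewhere.\<close>

lemma inj_substI:
  assumes "\<And>v. has_subst_value \<tau> (\<sigma> v) (uvar v)"
  shows "inj_subst \<sigma>"
  unfolding inj_subst_def
proof (intro allI impI)
  fix p assume "poly_subst \<sigma> p = 0"
  moreover have "has_subst_value \<tau> (poly_subst \<sigma> p) (Fract p 1)"
    using has_subst_value_poly_subst[of \<tau> \<sigma> uvar p] assms by (simp add: poly_subst_uvar)
  ultimately have "Fract p 1 = 0"
    using has_subst_value_0 has_subst_value_unique by metis
  then show "p = 0" by (simp add: Zero_fract_def eq_fract)
qed

section \<open>The field endomorphism given by an injective substitution\<close>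

context
  fixes \<sigma> :: "'r::{finite,linorder} \<times> nat \<Rightarrow> 'r uratfun"
  assumes inj: "inj_subst \<sigma>"
begin

lemma has_subst_value_rat_subst: "has_subst_value \<sigma> f (rat_subst \<sigma> f)"
proof -
  obtain a b where "f = Fract a b" "b \<noteq> 0" by (cases f)
  then have "has_subst_value \<sigma> f (poly_subst \<sigma> a / poly_subst \<sigma> b)"
    using inj by (intro has_subst_valueI) (auto simp: inj_subst_def)
  then show ?thesis using rat_subst_eqI by metis
qed

lemma rat_subst_eq_0_iff: "rat_subst \<sigma> f = 0 \<longleftrightarrow> f = 0"
proof
  assume 0: "rat_subst \<sigma> f = 0"
  obtain a b where f: "f = Fract a b" "b \<noteq> 0" by (cases f)
  then have "poly_subst \<sigma> a / poly_subst \<sigma> b = 0" "poly_subst \<sigma> b \<noteq> 0"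
    using inj 0 by (auto simp: inj_subst_def rat_subst_Fract)
  then show "f = 0" using inj f by (auto simp: inj_subst_def fract_collapse)
qed (use rat_subst_eqI[OF has_subst_value_0] in simp)

lemma rat_subst_0: "rat_subst \<sigma> 0 = 0"
  by (simp add: rat_subst_eq_0_iff)

lemma rat_subst_1: "rat_subst \<sigma> 1 = 1"
  by (rule rat_subst_eqI[OF has_subst_value_1])

lemma rat_subst_uvar: "rat_subst \<sigma> (uvar v) = \<sigma> v"
  by (rule rat_subst_eqI[OF has_subst_value_uvar])

lemma rat_subst_diff: "rat_subst \<sigma> (f - g) = rat_subst \<sigma> f - rat_subst \<sigma> g"
  by (intro rat_subst_eqI has_subst_value_diff has_subst_value_rat_subst)

lemma rat_subst_mult: "rat_subst \<sigma> (f * g) = rat_subst \<sigma> f * rat_subst \<sigma> g"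
  by (intro rat_subst_eqI has_subst_value_mult has_subst_value_rat_subst)

lemma rat_subst_power: "rat_subst \<sigma> (f ^ n) = rat_subst \<sigma> f ^ n"
  by (intro rat_subst_eqI has_subst_value_power has_subst_value_rat_subst)

lemma rat_subst_prod: "rat_subst \<sigma> (\<Prod>x\<in>A. f x) = (\<Prod>x\<in>A. rat_subst \<sigma> (f x))"
  by (intro rat_subst_eqI has_subst_value_prod has_subst_value_rat_subst)

text \<open>At f = 0 both sides are 0, since \<open>inverse 0 = 0\<close>. Hence this law, and those
  for division and integer powers built on it, carry no side condition.\<close>

lemma rat_subst_inverse: "rat_subst \<sigma> (inverse f) = inverse (rat_subst \<sigma> f)"
proof (cases "f = 0")
  case False
  then show ?thesis
    by (intro rat_subst_eqI has_subst_value_inverse has_subst_value_rat_subst)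
      (simp add: rat_subst_eq_0_iff)
qed (simp add: rat_subst_0)

lemma rat_subst_divide: "rat_subst \<sigma> (f / g) = rat_subst \<sigma> f / rat_subst \<sigma> g"
  by (simp add: divide_inverse rat_subst_mult rat_subst_inverse)

lemma rat_subst_power_int: "rat_subst \<sigma> (f powi n) = rat_subst \<sigma> f powi n"
  by (simp add: power_int_def rat_subst_power rat_subst_inverse)

end

section \<open>The recursions\<close>

text \<open>A coroot is normalised so that its root takes the value 2 on it.\<close>

lemma (in lie_algebra) cartan_matrix_diag:
  assumes "cartan_matrix C"
  shows "C i i = 2"
proof -
  obtain h a H where "coroot h (a i) (H i)" "of_int (C i i) = a i (H i)"
    using assms unfolding cartan_matrix_def by blast
  then have "of_int (C i i) = (of_int 2 :: complex)"
    by (simp add: coroot_def)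
  then show ?thesis by (simp only: of_int_eq_iff)
qed

lemma u_nonzero [simp]: "u \<alpha> \<noteq> 0"
  by (simp add: u_def)

lemma ui_nonzero [simp]: "ui \<alpha> i \<noteq> 0"
  by (simp add: ui_def)

context
  fixes C :: "'r::{finite,linorder} \<Rightarrow> 'r \<Rightarrow> int"
  assumes diag: "\<And>\<alpha>. C \<alpha> \<alpha> = 2"
begin

text \<open>Isolates the power of \<open>u\<close> \<alpha>, which will cancel against the square in
  the denominator of Q \<alpha> 2.\<close>

lemma prod_u_power_int_diag:
  "(\<Prod>\<beta>\<in>UNIV. u \<beta> powi C \<beta> \<alpha>) = u \<alpha> ^ 2 * (\<Prod>\<beta>\<in>UNIV - {\<alpha>}. u \<beta> powi C \<beta> \<alpha>)"
  by (subst prod.remove[of _ \<alpha>]) (auto simp: diag)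

text \<open>If the product were 1, the square of \<open>u\<close> \<alpha> would equal a Laurent
  monomial R in the other variables. Setting \<open>u\<close> \<alpha> to 0 and the others to 1
  turns this into 0 = 1. The lemma ensures that Q \<alpha> 2 is nonzero.\<close>

lemma prod_u_power_int_neq_1: "(\<Prod>\<beta>\<in>UNIV. u \<beta> powi C \<beta> \<alpha>) \<noteq> 1"
proof
  define R where "R = (\<Prod>\<beta>\<in>UNIV - {\<alpha>}. u \<beta> powi (- C \<beta> \<alpha>))"
  \<comment> \<open>The value 1 at the other variables keeps R defined whatever the signs of its
    exponents.\<close>
  define \<sigma> :: "'r \<times> nat \<Rightarrow> 'r uratfun" where "\<sigma> v = (if v = (\<alpha>, 0) then 0 else 1)" for v
  assume 1: "(\<Prod>\<beta>\<in>UNIV. u \<beta> powi C \<beta> \<alpha>) = 1"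
  have "u \<alpha> ^ 2 = u \<alpha> ^ 2 * ((\<Prod>\<beta>\<in>UNIV - {\<alpha>}. u \<beta> powi C \<beta> \<alpha>) * R)"
    unfolding R_def by (simp add: power_int_minus flip: prod.distrib)
  also have "\<dots> = R"
    using 1 unfolding prod_u_power_int_diag by (simp flip: mult.assoc)
  finally have "u \<alpha> ^ 2 = R" .
  moreover have u_val: "has_subst_value \<sigma> (u \<beta>) (\<sigma> (\<beta>, 0))" for \<beta>
    unfolding u_def by (rule has_subst_value_uvar)
  have "has_subst_value \<sigma> (u \<alpha> ^ 2) (0 ^ 2)"
    using u_val[of \<alpha>] by (intro has_subst_value_power) (simp add: \<sigma>_def)
  moreover have "has_subst_value \<sigma> (u \<beta>) 1" if "\<beta> \<noteq> \<alpha>" for \<beta>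
    using u_val[of \<beta>] that by (simp add: \<sigma>_def)
  then have "has_subst_value \<sigma> R (\<Prod>\<beta>\<in>UNIV - {\<alpha>}. 1 powi (- C \<beta> \<alpha>))"
    unfolding R_def by (intro has_subst_value_prod has_subst_value_power_int) auto
  ultimately show False
    using has_subst_value_unique[of \<sigma> R "0 ^ 2" 1] by simp
qed

lemma inj_subst_u_prime:
  assumes Q1: "\<And>\<alpha>. Q \<alpha> 1 = inverse (u \<alpha>)"
    and Q2: "\<And>\<alpha>. Q \<alpha> 2 = (1 - (\<Prod>\<beta>\<in>UNIV. u \<beta> powi C \<beta> \<alpha>)) / (u \<alpha> ^ 2 * ui \<alpha> 1)"
  shows "inj_subst (u_prime Q)"
proof -
  define P where "P \<alpha> = 1 - (\<Prod>\<beta>\<in>UNIV. u \<beta> powi C \<beta> \<alpha>)" for \<alpha>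
  \<comment> \<open>Found by solving for the inverse of \<open>u_prime Q\<close> with every
    \<open>u\<close> \<alpha> fixed; P \<alpha> is then fixed too. From u' at (\<alpha>, 0), which
    is \<open>u\<close> \<alpha> ^ 2 * \<open>ui\<close> \<alpha> 1 / P \<alpha>, having value
    \<open>u\<close> \<alpha>, one gets the entry at index 1. The factor Q \<alpha> 1 =
    \<open>inverse (u\<close> \<alpha>\<open>)\<close> gives the entry at index 2, and later indices
    drop by one.\<close>
  define \<tau> :: "'r \<times> nat \<Rightarrow> 'r uratfun" where
    "\<tau> = (\<lambda>(\<alpha>, i). if i = 0 then u \<alpha> else if i = 1 then P \<alpha> / u \<alpha>
      else if i = 2 then u \<alpha> * ui \<alpha> 1 else ui \<alpha> (i - 1))"
  have P_nonzero: "P \<alpha> \<noteq> 0" for \<alpha>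
    using prod_u_power_int_neq_1[of \<alpha>] by (simp add: P_def)
  have u_val: "has_subst_value \<tau> (u \<alpha>) (u \<alpha>)" for \<alpha>
    using has_subst_value_uvar[of \<tau> "(\<alpha>, 0)"] by (simp add: \<tau>_def u_def)
  have ui_val: "has_subst_value \<tau> (ui \<alpha> i) (\<tau> (\<alpha>, i))" for \<alpha> i
    unfolding ui_def by (rule has_subst_value_uvar)
  have P_val: "has_subst_value \<tau> (P \<alpha>) (P \<alpha>)" for \<alpha>
    unfolding P_def
    by (intro has_subst_value_diff has_subst_value_1 has_subst_value_prod
        has_subst_value_power_int u_val u_nonzero)
  show ?thesis
  proof (rule inj_substI[of \<tau>])
    fix v :: "'r \<times> nat"
    show "has_subst_value \<tau> (u_prime Q v) (uvar v)"
    proof (cases "(Q, v)" rule: u_prime.cases)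
      case (1 Q' \<alpha>)
      then have v: "v = (\<alpha>, 0)" by simp
      have "has_subst_value \<tau> (u \<alpha> ^ 2 * ui \<alpha> 1 / P \<alpha>) (u \<alpha> ^ 2 * (P \<alpha> / u \<alpha>) / P \<alpha>)"
        using ui_val[of \<alpha> 1]
        by (intro has_subst_value_divide has_subst_value_mult has_subst_value_power
            u_val P_val P_nonzero) (simp add: \<tau>_def)
      then show ?thesis
        using P_nonzero[of \<alpha>] by (simp add: v Q2 P_def[symmetric] power2_eq_square u_def[symmetric])
    next
      case (2 Q' \<alpha>)
      then have v: "v = (\<alpha>, Suc 0)" by simp
      have "has_subst_value \<tau> (inverse (u \<alpha>) * ui \<alpha> 2) (inverse (u \<alpha>) * (u \<alpha> * ui \<alpha> 1))"
        using ui_val[of \<alpha> 2]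
        by (intro has_subst_value_mult has_subst_value_inverse u_val u_nonzero) (simp add: \<tau>_def)
      then show ?thesis
        using Q1[of \<alpha>] by (simp add: v ui_def[of _ "Suc 0"] flip: mult.assoc)
    next
      case (3 Q' \<alpha> n)
      then have v: "v = (\<alpha>, Suc (Suc n))" by simp
      show ?thesis
        using ui_val[of \<alpha> "Suc (Suc (Suc n))"] by (simp add: v \<tau>_def ui_def)
    qed
  qed
qed

text \<open>Multiplying numerator and denominator by \<open>u\<close> \<alpha> ^ 2 turns the leading
  term into 1 and completes the product by its diagonal factor; the two sign changes in the
  exponents cancel. Thus both descriptions prescribe the same Q \<alpha> 2.\<close>

lemma recursion_at_1_iff:
  assumes "\<And>\<beta>. Q \<beta> 0 = 1" and "\<And>\<beta>. Q \<beta> 1 = inverse (u \<beta>)"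
  shows "(Q \<alpha> 1 ^ 2 - (\<Prod>\<beta>\<in>UNIV - {\<alpha>}. Q \<beta> 1 powi (- C \<beta> \<alpha>))) / (ui \<alpha> 1 * Q \<alpha> 0) =
    (1 - (\<Prod>\<beta>\<in>UNIV. u \<beta> powi C \<beta> \<alpha>)) / (u \<alpha> ^ 2 * ui \<alpha> 1)"
proof -
  have "(inverse (u \<alpha>) ^ 2 - X) / (ui \<alpha> 1 * 1) = (1 - u \<alpha> ^ 2 * X) / (u \<alpha> ^ 2 * ui \<alpha> 1)" for X
    by (simp add: divide_simps)
  then show ?thesis
    unfolding prod_u_power_int_diag assms power_int_minus power_int_inverse inverse_inverse_eq .
qed

text \<open>The substitution is a field endomorphism, so it acts on each factor separately. The
  hypothesis \<open>shift\<close> stops at k, so that the lemma can be used inside an induction that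
  is still establishing the shift.\<close>

lemma rat_subst_recursion:
  assumes Q0: "\<And>\<alpha>. Q \<alpha> 0 = 1"
    and Q1: "\<And>\<alpha>. Q \<alpha> 1 = inverse (u \<alpha>)"
    and Q2: "\<And>\<alpha>. Q \<alpha> 2 = (1 - (\<Prod>\<beta>\<in>UNIV. u \<beta> powi C \<beta> \<alpha>)) / (u \<alpha> ^ 2 * ui \<alpha> 1)"
    and shift: "\<And>\<alpha> j. 1 \<le> j \<Longrightarrow> j \<le> k \<Longrightarrow> Q \<alpha> (j + 1) = rat_subst (u_prime Q) (Q \<alpha> j)"
    and k: "1 \<le> k"
  shows "rat_subst (u_prime Q)
      ((Q \<alpha> k ^ 2 - (\<Prod>\<beta>\<in>UNIV - {\<alpha>}. Q \<beta> k powi (- C \<beta> \<alpha>))) / (ui \<alpha> k * Q \<alpha> (k - 1))) =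
    (Q \<alpha> (k + 1) ^ 2 - (\<Prod>\<beta>\<in>UNIV - {\<alpha>}. Q \<beta> (k + 1) powi (- C \<beta> \<alpha>))) /
      (ui \<alpha> (k + 1) * Q \<alpha> k)"
proof -
  note inj = inj_subst_u_prime[OF Q1 Q2]
  have "rat_subst (u_prime Q) (ui \<alpha> k) * rat_subst (u_prime Q) (Q \<alpha> (k - 1)) =
      ui \<alpha> (k + 1) * Q \<alpha> k"
  \<comment> \<open>At k = 1 the denominator contains Q \<alpha> 0, where \<open>shift\<close> says
    nothing: it stays 1, and the factor Q \<alpha> 1 comes from the image of \<open>ui\<close>
    \<alpha> 1 instead.\<close>
  proof (cases "k = 1")
    case True
    then show ?thesis
      using Q0 by (simp add: ui_def[of \<alpha> "Suc 0"] rat_subst_uvar[OF inj] rat_subst_1[OF inj]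
          eval_nat_numeral)
  next
    case False
    then obtain n where n: "k = Suc (Suc n)"
      using k by (metis One_nat_def Suc_le_D old.nat.exhaust)
    then have "rat_subst (u_prime Q) (ui \<alpha> k) = ui \<alpha> (k + 1)"
      by (simp add: ui_def rat_subst_uvar[OF inj])
    then show ?thesis
      using shift[of "k - 1" \<alpha>] by (simp add: n)
  qed
  then show ?thesis
    using k by (simp add: rat_subst_divide[OF inj] rat_subst_mult[OF inj] rat_subst_diff[OF inj]
        rat_subst_power[OF inj] rat_subst_prod[OF inj] rat_subst_power_int[OF inj]
        flip: shift[of k, simplified])
qed

end

theorem lemma4p2:
  fixes scale :: "complex \<Rightarrow> 'g::ab_group_add \<Rightarrow> 'g"
    and bracket :: "'g \<Rightarrow> 'g \<Rightarrow> 'g"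
    and C :: "'r::{finite,linorder} \<Rightarrow> 'r \<Rightarrow> int"
    and Q :: "'r \<Rightarrow> nat \<Rightarrow> 'r uratfun"
  assumes "simple_lie_algebra scale bracket"
    and "lie_algebra.cartan_matrix scale bracket C"
    and "simply_laced C"
  shows
    "(\<forall>\<alpha>. Q \<alpha> 0 = 1 \<and> Q \<alpha> 1 = inverse (u \<alpha>) \<and>
        (\<forall>k\<ge>1. Q \<alpha> (k + 1) =
           (Q \<alpha> k ^ 2 - (\<Prod>\<beta>\<in>UNIV - {\<alpha>}. Q \<beta> k powi (- C \<beta> \<alpha>))) / (ui \<alpha> k * Q \<alpha> (k - 1))))
     \<longleftrightarrow>
     (\<forall>\<alpha>. Q \<alpha> 0 = 1 \<and> Q \<alpha> 1 = inverse (u \<alpha>) \<and>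
        Q \<alpha> 2 = (1 - (\<Prod>\<beta>\<in>UNIV. u \<beta> powi C \<beta> \<alpha>)) / (u \<alpha> ^ 2 * ui \<alpha> 1) \<and>
        (\<forall>k\<ge>1. Q \<alpha> (k + 1) = rat_subst (u_prime Q) (Q \<alpha> k)))"
    (is "?L \<longleftrightarrow> ?R")
proof -
  interpret simple_lie_algebra scale bracket by fact
  have diag: "C \<alpha> \<alpha> = 2" for \<alpha>
    by (rule cartan_matrix_diag) fact
  note at_1 = recursion_at_1_iff[of C Q, OF diag]
  note step = rat_subst_recursion[of C Q, OF diag]
  show ?thesis
  proof
    assume L: ?L
    then have Q0: "Q \<alpha> 0 = 1" and Q1: "Q \<alpha> 1 = inverse (u \<alpha>)"
      and rec: "1 \<le> k \<Longrightarrow> Q \<alpha> (k + 1) =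
        (Q \<alpha> k ^ 2 - (\<Prod>\<beta>\<in>UNIV - {\<alpha>}. Q \<beta> k powi (- C \<beta> \<alpha>))) / (ui \<alpha> k * Q \<alpha> (k - 1))"
      for \<alpha> k by blast+
    have Q2: "Q \<alpha> 2 = (1 - (\<Prod>\<beta>\<in>UNIV. u \<beta> powi C \<beta> \<alpha>)) / (u \<alpha> ^ 2 * ui \<alpha> 1)" for \<alpha>
      using rec[of 1 \<alpha>] at_1[OF Q0 Q1, of \<alpha>] by (simp add: numeral_2_eq_2)
    note inj = inj_subst_u_prime[of C Q, OF diag Q1 Q2]
    have "\<forall>\<alpha>. Q \<alpha> (k + 1) = rat_subst (u_prime Q) (Q \<alpha> k)" if "1 \<le> k" for k
      using that
    \<comment> \<open>Strong induction, because \<open>step\<close> asks for the shift at all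
      indices up to n and for every root.\<close>
    proof (induction k rule: less_induct)
      case (less k)
      show ?case
      proof (cases "k = 1")
        \<comment> \<open>The substitution sends \<open>inverse (u\<close> \<alpha>\<open>)\<close>
          to the inverse of 1 / Q \<alpha> 2, which is Q \<alpha> 2.\<close>
        case True
        then show ?thesis
          unfolding True Q1
          by (simp add: rat_subst_inverse[OF inj] u_def rat_subst_uvar[OF inj] numeral_2_eq_2)
      next
        case False
        then obtain n where n: "k = n + 1" "1 \<le> n" using less.prems by (cases k) auto
        \<comment> \<open>Expand Q \<alpha> k by the recursion at n, transport it to the recursion
          at n + 1, and contract that again to Q \<alpha> (n + 2).\<close>
        then have "rat_subst (u_prime Q) (Q \<alpha> k) = Q \<alpha> (k + 1)" for \<alpha>
          unfolding n(1) rec[OF n(2)]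
          using step[of n \<alpha>, OF Q0 Q1 Q2] less.IH n rec[of "n + 1" \<alpha>] by simp
        then show ?thesis by simp
      qed
    qed
    then show ?R using Q0 Q1 Q2 by blast
  next
    assume R: ?R
    then have Q0: "Q \<alpha> 0 = 1" and Q1: "Q \<alpha> 1 = inverse (u \<alpha>)"
      and Q2: "Q \<alpha> 2 = (1 - (\<Prod>\<beta>\<in>UNIV. u \<beta> powi C \<beta> \<alpha>)) / (u \<alpha> ^ 2 * ui \<alpha> 1)"
      and shift: "1 \<le> k \<Longrightarrow> Q \<alpha> (k + 1) = rat_subst (u_prime Q) (Q \<alpha> k)"
      for \<alpha> k by blast+
    have "\<forall>\<alpha>. Q \<alpha> (k + 1) =
        (Q \<alpha> k ^ 2 - (\<Prod>\<beta>\<in>UNIV - {\<alpha>}. Q \<beta> k powi (- C \<beta> \<alpha>))) / (ui \<alpha> k * Q \<alpha> (k - 1))"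
      if "1 \<le> k" for k
      using that
    \<comment> \<open>The shift now holds at every index, so ordinary induction is enough: the
      recursion at k is substituted into the shift at k + 1.\<close>
    proof (induction k rule: nat_induct_at_least)
      case base
      show ?case using Q2 at_1[OF Q0 Q1] by (simp add: numeral_2_eq_2)
    next
      case (Suc k)
      show ?case
      proof
        fix \<alpha>
        have "Q \<alpha> (Suc k + 1) = rat_subst (u_prime Q) (Q \<alpha> (k + 1))"
          using shift[of "Suc k" \<alpha>] by simp
        also have "\<dots> = (Q \<alpha> (k + 1) ^ 2 - (\<Prod>\<beta>\<in>UNIV - {\<alpha>}. Q \<beta> (k + 1) powi (- C \<beta> \<alpha>))) /
            (ui \<alpha> (k + 1) * Q \<alpha> k)"
          by (subst Suc.IH[rule_format, of \<alpha>]) (rule step[OF Q0 Q1 Q2 shift Suc.hyps])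
        finally show "Q \<alpha> (Suc k + 1) =
            (Q \<alpha> (Suc k) ^ 2 - (\<Prod>\<beta>\<in>UNIV - {\<alpha>}. Q \<beta> (Suc k) powi (- C \<beta> \<alpha>))) /
              (ui \<alpha> (Suc k) * Q \<alpha> (Suc k - 1))" by simp
      qed
    qed
    then show ?L using Q0 Q1 by blast
  qed
qed

end
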